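(* Let $\Delta,\Sigma$ be alphabets, $\varphi:\Delta\to2^{\Sigma^*}$ a regular language substitution, $R\subseteq\Sigma^*$ a regular language, and $M'\subseteq\Delta^*$ a regular language that has 1-word summaries and satisfies $\varphi(M')\subseteq R$. Then there exists $w\in M'$ with $\varphi(w)=R$ if and only if there exists a finite subset $F\subseteq M'$ with $\varphi(F)=\varphi(M')=R$.
   Context: A regular language substitution $\varphi:\Delta\to2^{\Sigma^*}$ maps each symbol to a regular language over $\Sigma$, extended to words by $\varphi(\varepsilon)=\{\varepsilon\}$, $\varphi(\delta w)=\varphi(\delta)\varphi(w)$, and to sets of words by $\varphi(L)=\bigcup_{w\in L}\varphi(w)$. A language $M'\subseteq\Delta^*$ has 1-word summaries if for every finite subset $F\subseteq M'$ there exists a word $w\in M'$ with $\varphi(F)\subseteq\varphi(w)$. *)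

theory Defs
  imports Main
begin

datatype 'a rexp = Zero | One | Atom 'a | Plus "'a rexp" "'a rexp"
  | Times "'a rexp" "'a rexp" | Star "'a rexp"

definition conc :: "'a list set \<Rightarrow> 'a list set \<Rightarrow> 'a list set" where
  "conc A B = {u @ v | u v. u \<in> A \<and> v \<in> B}"

definition star :: "'a list set \<Rightarrow> 'a list set" where
  "star A = {concat ws | ws. set ws \<subseteq> A}"

fun lang :: "'a rexp \<Rightarrow> 'a list set" where
  "lang Zero = {}"
| "lang One = {[]}"
| "lang (Atom a) = {[a]}"
| "lang (Plus r s) = lang r \<union> lang s"
| "lang (Times r s) = conc (lang r) (lang s)"
| "lang (Star r) = star (lang r)"

definition regular :: "'a list set \<Rightarrow> bool" where
  "regular L \<longleftrightarrow> (\<exists>r. lang r = L)"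

fun subst_word :: "('d \<Rightarrow> 's list set) \<Rightarrow> 'd list \<Rightarrow> 's list set" where
  "subst_word \<phi> [] = {[]}"
| "subst_word \<phi> (d # w) = conc (\<phi> d) (subst_word \<phi> w)"

definition subst_lang :: "('d \<Rightarrow> 's list set) \<Rightarrow> 'd list set \<Rightarrow> 's list set" where
  "subst_lang \<phi> L = (\<Union>w\<in>L. subst_word \<phi> w)"

definition regular_subst :: "('d \<Rightarrow> 's list set) \<Rightarrow> bool" where
  "regular_subst \<phi> \<longleftrightarrow> (\<forall>d. regular (\<phi> d))"

definition has_1word_summaries :: "('d \<Rightarrow> 's list set) \<Rightarrow> 'd list set \<Rightarrow> bool" where
  "has_1word_summaries \<phi> M \<longleftrightarrow>
     (\<forall>F. finite F \<and> F \<subseteq> M \<longrightarrow> (\<exists>w\<in>M. subst_lang \<phi> F \<subseteq> subst_word \<phi> w))"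

end

theory Submission
  imports Defs
begin

text \<open>A word of \<open>M\<close> whose image is \<open>R\<close> is itself the
  required finite subset. Conversely, a 1-word summary of a finite \<open>F\<close> with image \<open>R\<close>
  has image between \<open>\<phi>(F) = R\<close> and \<open>\<phi>(M) = R\<close>.\<close>

lemma subst_lang_singleton [simp]: "subst_lang \<phi> {w} = subst_word \<phi> w"
  by (simp add: subst_lang_def)

lemma subst_word_subset_subst_lang: "w \<in> L \<Longrightarrow> subst_word \<phi> w \<subseteq> subst_lang \<phi> L"
  by (auto simp: subst_lang_def)

lemma subst_word_eq_if_summary:
  assumes "w \<in> M" and "subst_lang \<phi> F \<subseteq> subst_word \<phi> w"
    and "subst_lang \<phi> F = R" and "subst_lang \<phi> M \<subseteq> R"
  shows "subst_word \<phi> w = R"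
  using assms subst_word_subset_subst_lang[OF \<open>w \<in> M\<close>, of \<phi>] by blast

theorem proposition13:
  fixes \<phi> :: "'d::finite \<Rightarrow> 's::finite list set"
    and R :: "'s list set"
    and M :: "'d list set"
  assumes "regular_subst \<phi>"
    and "regular R"
    and "regular M"
    and "has_1word_summaries \<phi> M"
    and "subst_lang \<phi> M \<subseteq> R"
  shows "(\<exists>w\<in>M. subst_word \<phi> w = R) \<longleftrightarrow>
         (\<exists>F. finite F \<and> F \<subseteq> M \<and> subst_lang \<phi> F = subst_lang \<phi> M \<and> subst_lang \<phi> M = R)"
proof
  assume "\<exists>w\<in>M. subst_word \<phi> w = R"
  then obtain w where "w \<in> M" and w_R: "subst_word \<phi> w = R" by blast
  then have "subst_lang \<phi> M = R"
    using assms(5) subst_word_subset_subst_lang[of w M \<phi>] by blast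
  with \<open>w \<in> M\<close> w_R show "\<exists>F. finite F \<and> F \<subseteq> M \<and> subst_lang \<phi> F = subst_lang \<phi> M \<and> subst_lang \<phi> M = R"
    by (intro exI[of _ "{w}"]) simp
next
  assume "\<exists>F. finite F \<and> F \<subseteq> M \<and> subst_lang \<phi> F = subst_lang \<phi> M \<and> subst_lang \<phi> M = R"
  then obtain F where "finite F" "F \<subseteq> M" and F_R: "subst_lang \<phi> F = R" by auto
  then obtain w where "w \<in> M" "subst_lang \<phi> F \<subseteq> subst_word \<phi> w"
    using assms(4) unfolding has_1word_summaries_def by blast
  with F_R assms(5) show "\<exists>w\<in>M. subst_word \<phi> w = R"
    using subst_word_eq_if_summary by blast
qed

end
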